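(* Suppose that $m\mapsto F(m)m$ is convex on $(a,b)$. Consider the following two conditions on a constraint set $\mathcal{C}$ with set of positive-demand menus $\mathcal{C}_p$ and set of $1$-separating menus $\mathcal{C}_1$: (i) whenever $C=\{(p_1,q_1),\ldots,(p_k,q_k)\}\in\mathcal{C}_p$ (with $p_1\le\cdots\le p_k$), there exists $\{(p,q)\}\in\mathcal{C}_1$ such that $p\ge p_k$ and $q\ge q_k$; (ii) if $\{(p,q)\}\in\mathcal{C}_1$ is such that $p\ge p'$ for all $\{(p',q')\}\in\mathcal{C}_1$, then $p\le p^M(q)$. Then: 1. There exists a constraint set $\mathcal{C}$, with $\mathcal{C}_1$ nonempty, that satisfies condition (i) and such that there is a menu $C\in\mathcal{C}$ that is not $1$-separating and yields strictly more revenue than any $1$-separating menu in $\mathcal{C}$. 2. There exists a constraint set $\mathcal{C}'$, with $\mathcal{C}'_1$ nonempty, that satisfies condition (ii) and such that there is a menu $C'\in\mathcal{C}'$ that is not $1$-separating and yields strictly more revenue than any $1$-separating menu in $\mathcal{C}'$.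
   Context: Buyers' types $m$ are distributed according to a continuous cumulative distribution function $F$ (on $\mathbb{R}$) with a density $f$, supported on an interval $[a,b]\subseteq[0,\infty)$, $a<b$ (so $F$ is strictly increasing on $[a,b]$, $F(a)=0$, $F(b)=1$). A menu is a finite nonempty set $C=\{(p_1,q_1),\ldots,(p_k,q_k)\}$ of distinct price-quality pairs with $p_i\ge 0$, $q_i>0$, labeled so that $p_1\le\cdots\le p_k$. A type $m$ buyer gets utility $mq-p$ from the pair $(p,q)$ and $0$ from not buying. The demand for $(p_i,q_i)$ is $$D_i(C)=\int_a^b 1\{mq_i-p_i\ge 0\}\,1\{mq_i-p_i=\max_{(p_j,q_j)\in C}(mq_j-p_j)\}\,F(dm)$$ (ties have mass zero), and the revenue is $\pi(C)=\sum_{(p_i,q_i)\in C}p_iD_i(C)$. A constraint set $\mathcal{C}$ is a nonempty set of menus. $\mathcal{C}_p=\{C\in\mathcal{C}: D_i(C)>0 \text{ for all } (p_i,q_i)\in C\}$. A menu $C\in\mathcal{C}_p$ is $k$-separating if it has exactly $k$ pairs; $\mathcal{C}_1\subseteq\mathcal{C}_p$ is the set of $1$-separating menus. For $q>0$, $p^M(q)=\inf\operatorname{argmax}_{p\ge0}\,p\,(1-F(p/q))$. *)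

theory Defs
  imports "HOL-Probability.Probability"
begin

text \<open>
  Buyers' types: a continuous cumulative distribution function \<open>F\<close> with density \<open>f\<close> and support
  \<open>{a..b}\<close>. The measure \<open>F(dm)\<close> is the Lebesgue-Stieltjes measure \<^term>\<open>interval_measure F\<close>.
\<close>

locale type_distribution =
  fixes F f :: "real \<Rightarrow> real" and a b :: real
  assumes mono_F: "mono F"
    and continuous_F: "continuous_on UNIV F"
    and F_at_bot: "(F \<longlongrightarrow> 0) at_bot"
    and F_at_top: "(F \<longlongrightarrow> 1) at_top"
    and measurable_f: "f \<in> borel_measurable borel"
    and nonneg_f: "\<And>x. 0 \<le> f x"
    and density_f: "interval_measure F = density lborel (\<lambda>x. ennreal (f x))"
    and interval: "0 \<le> a" "a < b"
    and F_a: "F a = 0"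
    and F_b: "F b = 1"
    and strict_mono_F: "strict_mono_on {a..b} F"

text \<open>Pairs are ordered as (price, quality).\<close>

type_synonym menu = "(real \<times> real) set"

definition is_menu :: "menu \<Rightarrow> bool" where
  "is_menu C \<longleftrightarrow> finite C \<and> C \<noteq> {} \<and> (\<forall>(p, q)\<in>C. 0 \<le> p \<and> 0 < q)"

definition demand :: "(real \<Rightarrow> real) \<Rightarrow> real \<Rightarrow> real \<Rightarrow> menu \<Rightarrow> real \<times> real \<Rightarrow> real" where
  "demand F a b C = (\<lambda>(p, q). LINT m:{a..b}|interval_measure F.
     of_bool (0 \<le> m * q - p) * of_bool (m * q - p = Max ((\<lambda>(p', q'). m * q' - p') ` C)))"

definition revenue :: "(real \<Rightarrow> real) \<Rightarrow> real \<Rightarrow> real \<Rightarrow> menu \<Rightarrow> real" where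
  "revenue F a b C = (\<Sum>(p, q)\<in>C. p * demand F a b C (p, q))"

definition constraint_set :: "menu set \<Rightarrow> bool" where
  "constraint_set \<C> \<longleftrightarrow> \<C> \<noteq> {} \<and> (\<forall>C\<in>\<C>. is_menu C)"

definition positive_demand :: "(real \<Rightarrow> real) \<Rightarrow> real \<Rightarrow> real \<Rightarrow> menu set \<Rightarrow> menu set" where
  "positive_demand F a b \<C> = {C \<in> \<C>. \<forall>x\<in>C. 0 < demand F a b C x}"

definition separating ::
    "(real \<Rightarrow> real) \<Rightarrow> real \<Rightarrow> real \<Rightarrow> nat \<Rightarrow> menu set \<Rightarrow> menu set" where
  "separating F a b k \<C> = {C \<in> positive_demand F a b \<C>. card C = k}"

definition monopoly_price :: "(real \<Rightarrow> real) \<Rightarrow> real \<Rightarrow> real" where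
  "monopoly_price F q = Inf {p. is_arg_max (\<lambda>p. p * (1 - F (p / q))) (\<lambda>p. 0 \<le> p) p}"

text \<open>
  The last pair of a menu listed by increasing price is a pair of maximal price. It is unique in a
  menu with positive demands: of two pairs with equal price, the one of lower quality is chosen by
  a null set of types only.
\<close>

definition condition_i :: "(real \<Rightarrow> real) \<Rightarrow> real \<Rightarrow> real \<Rightarrow> menu set \<Rightarrow> bool" where
  "condition_i F a b \<C> \<longleftrightarrow>
     (\<forall>C\<in>positive_demand F a b \<C>. \<forall>(pk, qk)\<in>C. (\<forall>(p', q')\<in>C. p' \<le> pk) \<longrightarrow>
        (\<exists>p q. {(p, q)} \<in> separating F a b 1 \<C> \<and> pk \<le> p \<and> qk \<le> q))"

definition condition_ii :: "(real \<Rightarrow> real) \<Rightarrow> real \<Rightarrow> real \<Rightarrow> menu set \<Rightarrow> bool" where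
  "condition_ii F a b \<C> \<longleftrightarrow>
     (\<forall>p q. {(p, q)} \<in> separating F a b 1 \<C> \<longrightarrow>
        (\<forall>p' q'. {(p', q')} \<in> separating F a b 1 \<C> \<longrightarrow> p' \<le> p) \<longrightarrow>
        p \<le> monopoly_price F q)"

end

theory Submission
  imports Defs
begin

text \<open>
  Condition (i) alone allows the only single-pair menu to be priced close to \<open>b\<close> times its quality,
  where almost nobody buys; condition (ii) alone allows the only single-pair menu to be given away.
  Either is beaten by the menu \<open>{(0, 1/2), (c/2, 1)}\<close> with \<open>c = (a + b)/2\<close>, whose revenue
  \<open>c/2 * (1 - F c)\<close> is positive: types below \<open>c\<close> take the free pair, types above \<open>c\<close> the other.
\<close>

context type_distribution
begin

text \<open>If the buyers of a pair form an upper interval of types, demand is the mass of that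
  interval. Continuity of \<open>F\<close> rules out an atom at the marginal type
  \<open>t\<close>.\<close>

lemma demand_threshold:
  assumes t: "t \<in> {a..b}"
    and thr: "\<And>m. m \<in> {a..b} \<Longrightarrow>
      0 \<le> m * q - p \<and> m * q - p = Max ((\<lambda>(p', q'). m * q' - p') ` C) \<longleftrightarrow> t \<le> m"
  shows "demand F a b C (p, q) = 1 - F t"
proof -
  have "demand F a b C (p, q) = (LINT m|interval_measure F. indicator {t..b} m)"
    unfolding demand_def set_lebesgue_integral_def prod.case
  proof (rule Bochner_Integration.integral_cong)
    fix m
    show "indicator {a..b} m *\<^sub>R (of_bool (0 \<le> m * q - p) *
        of_bool (m * q - p = Max ((\<lambda>(p', q'). m * q' - p') ` C))) = (indicator {t..b} m :: real)"
      using t thr[of m] by (cases "m \<in> {a..b}") auto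
  qed simp
  also have "\<dots> = measure (interval_measure F) {t..b}"
    by simp
  also have "\<dots> = F b - F t"
    using t emeasure_interval_measure_Icc[of t b F] monoD[OF mono_F] continuous_F
    by (auto simp: measure_def)
  finally show ?thesis
    using F_b by simp
qed

lemma demand_singleton:
  assumes "q > 0" "p / q \<in> {a..b}"
  shows "demand F a b {(p, q)} (p, q) = 1 - F (p / q)"
  using assms by (intro demand_threshold) (auto simp: field_simps)

text \<open>Treated separately from positive prices: the break-even type \<open>0 / q\<close> may
  lie below \<open>a\<close>, so the threshold is \<open>a\<close> itself.\<close>

lemma demand_zero_price:
  assumes "q > 0"
  shows "demand F a b {(0, q)} (0, q) = 1"
proof -
  have "demand F a b {(0, q)} (0, q) = 1 - F a"
    using assms interval by (intro demand_threshold) auto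
  then show ?thesis
    using F_a by simp
qed

text \<open>The higher quality is weakly preferred iff \<open>m - c/2 \<ge> m/2\<close>, that is
  \<open>m \<ge> c\<close>. The free pair adds no revenue, whatever its demand.\<close>

lemma revenue_two_pairs:
  assumes "c \<in> {a..b}"
  shows "revenue F a b {(0, 1/2), (c/2, 1)} = c/2 * (1 - F c)"
proof -
  have "demand F a b {(0, 1/2), (c/2, 1)} (c/2, 1) = 1 - F c"
    using assms interval by (intro demand_threshold) (auto simp: max_def)
  then show ?thesis
    unfolding revenue_def by simp
qed

text \<open>An infimum is bounded below this way only over a nonempty set, so a maximiser has to be
  exhibited. Compactness gives one on \<open>{0..b * q}\<close>; at higher prices nobody buys and
  profit is at most its value at price 0.\<close>

lemma monopoly_price_nonneg:
  assumes "q > 0"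
  shows "0 \<le> monopoly_price F q"
proof -
  define g where "g p = p * (1 - F (p / q))" for p
  have cont: "continuous_on {0..b * q} g"
    unfolding g_def using continuous_F assms
    by (intro continuous_intros continuous_on_compose2[OF continuous_F]) auto
  have bq: "0 \<le> b * q"
    using assms interval by simp
  obtain p where p: "p \<in> {0..b * q}" and max: "\<And>y. y \<in> {0..b * q} \<Longrightarrow> g y \<le> g p"
    using continuous_attains_sup[OF compact_Icc _ cont] bq by fastforce
  have "g y \<le> g p" if "0 \<le> y" for y
  proof (cases "y \<le> b * q")
    case False
    then have "F b \<le> F (y / q)"
      using assms by (intro monoD[OF mono_F]) (simp add: field_simps)
    then have "g y \<le> 0"
      unfolding g_def using F_b that by (simp add: mult_nonneg_nonpos)
    also have "0 = g 0"
      by (simp add: g_def)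
    also have "\<dots> \<le> g p"
      using bq by (intro max) simp
    finally show ?thesis .
  qed (use that max in auto)
  then have "is_arg_max g (\<lambda>p. 0 \<le> p) p"
    using p by (auto simp: is_arg_max_def not_less)
  then show ?thesis
    unfolding monopoly_price_def g_def[symmetric]
    by (intro cInf_greatest) (auto simp: is_arg_max_def)
qed

text \<open>The revenue \<open>P * (1 - F P)\<close> is continuous and vanishes at \<open>b\<close>,
  where \<open>F b = 1\<close>. Staying strictly below \<open>b\<close> keeps demand
  positive.\<close>

lemma exists_price_small_revenue:
  assumes "c < b" "0 < r"
  obtains P where "c < P" "P < b" "P * (1 - F P) < r"
proof -
  have "isCont (\<lambda>P. P * (1 - F P)) b"
    using continuous_F by (intro continuous_intros) (simp add: continuous_on_eq_continuous_at)
  then have "((\<lambda>P. P * (1 - F P)) \<longlongrightarrow> 0) (at_left b)"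
    using F_b by (auto simp: isCont_def intro: tendsto_within_subset)
  then have "\<forall>\<^sub>F P in at_left b. P * (1 - F P) < r"
    using assms(2) by (rule order_tendstoD)
  moreover have "\<forall>\<^sub>F P in at_left b. P \<in> {c<..<b}"
    using assms(1) by (rule eventually_at_left_real)
  ultimately have "\<exists>P. P * (1 - F P) < r \<and> P \<in> {c<..<b}"
    by (intro eventually_happens'[OF trivial_limit_at_left_real] eventually_conj)
  then show ?thesis
    using that by auto
qed

end

text \<open>The menu \<open>C\<close> is excluded by its cardinality alone, so its demands need not
  be computed.\<close>

lemma separating_singleton_pair:
  assumes "0 < demand F a b {x} x" "card C = 2"
  shows "separating F a b 1 {{x}, C} = {{x}}"
  using assms by (auto simp: separating_def positive_demand_def)

theorem proposition4:
  fixes F f :: "real \<Rightarrow> real" and a b :: real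
  assumes "type_distribution F f a b"
    and "convex_on {a<..<b} (\<lambda>m. F m * m)"
  shows "(\<exists>\<C>. constraint_set \<C> \<and> separating F a b 1 \<C> \<noteq> {} \<and> condition_i F a b \<C> \<and>
            (\<exists>C\<in>\<C>. C \<notin> separating F a b 1 \<C> \<and>
               (\<forall>S\<in>separating F a b 1 \<C>. revenue F a b S < revenue F a b C))) \<and>
         (\<exists>\<C>'. constraint_set \<C>' \<and> separating F a b 1 \<C>' \<noteq> {} \<and> condition_ii F a b \<C>' \<and>
            (\<exists>C'\<in>\<C>'. C' \<notin> separating F a b 1 \<C>' \<and>
               (\<forall>S\<in>separating F a b 1 \<C>'. revenue F a b S < revenue F a b C')))"
proof -
  interpret type_distribution F f a b
    by fact
  define c where "c = (a + b) / 2"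
  define C :: menu where "C = {(0, 1/2), (c/2, 1)}"
  have c: "a < c" "c < b" "0 < c"
    using interval by (auto simp: c_def)
  have F_less: "F x < 1" if "a \<le> x" "x < b" for x
    using strict_mono_onD[OF strict_mono_F, of x b] that F_b by auto
  have menu_C: "is_menu C" and card_C: "card C = 2"
    using c by (auto simp: C_def is_menu_def)
  have rev_C: "revenue F a b C = c/2 * (1 - F c)"
    unfolding C_def using c by (intro revenue_two_pairs) auto
  have rev_pos: "0 < revenue F a b C"
    unfolding rev_C using c F_less[of c] by simp
  obtain P where P: "c < P" "P < b" "P * (1 - F P) < revenue F a b C"
    using exists_price_small_revenue[OF c(2) rev_pos] by blast

  have dem_P: "demand F a b {(P, 1)} (P, 1) = 1 - F P"
    using demand_singleton[of 1 P] P c by simp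
  have sep_P: "separating F a b 1 {{(P, 1)}, C} = {{(P, 1)}}"
    using dem_P P c F_less[of P] card_C by (intro separating_singleton_pair) auto
  \<comment> \<open>The pair of maximal price in \<open>C\<close> is \<open>(c/2, 1)\<close>, and
    \<open>(P, 1)\<close> has the same quality and a price above \<open>c > c/2\<close>.\<close>
  have "condition_i F a b {{(P, 1)}, C}"
    unfolding condition_i_def sep_P using P c
    by (auto simp: positive_demand_def C_def)
  moreover have "revenue F a b {(P, 1)} < revenue F a b C"
    using P dem_P by (simp add: revenue_def)
  moreover have "constraint_set {{(P, 1)}, C}"
    using menu_C P c by (auto simp: constraint_set_def is_menu_def)
  moreover have "C \<noteq> {(P, 1)}"
    using card_C by auto
  ultimately have part1: "constraint_set {{(P, 1)}, C} \<and> separating F a b 1 {{(P, 1)}, C} \<noteq> {} \<and>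
      condition_i F a b {{(P, 1)}, C} \<and>
      (\<exists>C'\<in>{{(P, 1)}, C}. C' \<notin> separating F a b 1 {{(P, 1)}, C} \<and>
        (\<forall>S\<in>separating F a b 1 {{(P, 1)}, C}. revenue F a b S < revenue F a b C'))"
    unfolding sep_P by auto

  have sep_0: "separating F a b 1 {{(0, 1)}, C} = {{(0, 1)}}"
    using demand_zero_price[of 1] card_C by (intro separating_singleton_pair) auto
  \<comment> \<open>The only price to check is 0, so the condition reduces to nonnegativity of the
    monopoly price at quality 1.\<close>
  have "condition_ii F a b {{(0, 1)}, C}"
    unfolding condition_ii_def sep_0 using monopoly_price_nonneg[of 1] by simp
  moreover have "revenue F a b {(0, 1)} < revenue F a b C"
    using rev_pos by (simp add: revenue_def)
  moreover have "constraint_set {{(0, 1)}, C}"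
    using menu_C by (auto simp: constraint_set_def is_menu_def)
  moreover have "C \<noteq> {(0, 1)}"
    using card_C by auto
  ultimately have part2: "constraint_set {{(0, 1)}, C} \<and> separating F a b 1 {{(0, 1)}, C} \<noteq> {} \<and>
      condition_ii F a b {{(0, 1)}, C} \<and>
      (\<exists>C'\<in>{{(0, 1)}, C}. C' \<notin> separating F a b 1 {{(0, 1)}, C} \<and>
        (\<forall>S\<in>separating F a b 1 {{(0, 1)}, C}. revenue F a b S < revenue F a b C'))"
    unfolding sep_0 by auto
  from part1 part2 show ?thesis
    by blast
qed

end
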